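(* Let $\Omega\subset\mathbb{R}^d$ be open, bounded and convex, let $n\ge1$, let $\{\phi_i\}_{i=1}^n\subset C^2(\overline{\Omega})$ and $\Phi_n=(\phi_1,\ldots,\phi_n)$. Let $\{g_\varepsilon\}_{\varepsilon>0}\subset C^{1,1}(\mathbb{R})$ be an admissible smoothing family such that $g_\varepsilon(r)\le(r)_+$ for all $r\in\mathbb{R}$, $\varepsilon>0$, and such that there exists $s_0>0$ with $\lim_{\varepsilon\to0^+}\sup_{s\in[-s_0,0]}|g_\varepsilon'(s)|=0$. For $i\in\{1,\ldots,n\}$ set $$\Omega^i=\{x\in\overline{\Omega}:\ p_{n,i}(\Phi_n(x))=\max_{j=1,\ldots,n}p_{n,j}(\Phi_n(x))\},$$ $$\Omega^{i,\varepsilon}=\{x\in\overline{\Omega}:\ p_{n,i,\varepsilon}(\Phi_n(x))=\max_{j=1,\ldots,n}p_{n,j,\varepsilon}(\Phi_n(x))\}.$$ Then for every $x\in\overline{\Omega}$ and every $i\in\{1,\ldots,n\}$, $$\lim_{\varepsilon\to0^+}\chi_{\Omega^{i,\varepsilon}}(x)=\chi_{\Omega^i}(x),$$ where $\chi_\omega$ denotes the characteristic function of $\omega\subset\mathbb{R}^d$.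
   Context: $(x)_+=\max\{x,0\}$. A family $\{g_\varepsilon\}_{\varepsilon>0}\subset C^{1,1}(\mathbb{R})$ ($C^1$ functions with Lipschitz derivative) is called an admissible smoothing family if for every $\varepsilon>0$: $g_\varepsilon(x)\ge 0$ and $g_\varepsilon'(x)\in[0,1]$ for all $x\in\mathbb{R}$; $g_\varepsilon''(x)\ge 0$ for almost all $x\in\mathbb{R}$; $\sup_{x\in\mathbb{R}}|(x)_+-g_\varepsilon(x)|\le\varepsilon$; $g_\varepsilon''\in L^\infty(\mathbb{R})$; and, moreover, $g_\varepsilon'\to\chi_{[0,\infty)}$ uniformly on compact subsets of $\mathbb{R}\setminus\{0\}$ as $\varepsilon\to0^+$. The smoothed minimum of $a\in\mathbb{R}^n$ is defined recursively by $\psi_{1,\varepsilon}(a)=a_1$ and $\psi_{i+1,\varepsilon}(a)=a_{i+1}-g_\varepsilon(a_{i+1}-\psi_{i,\varepsilon}(a))$ for $i\in\{1,\ldots,n-1\}$. Set $p_{n,j,\varepsilon}(a)=\frac{\partial\psi_{n,\varepsilon}}{\partial a_j}(a)$ and $p_{n,j}(a)=\lim_{\varepsilon\to0^+}p_{n,j,\varepsilon}(a)$; under the assumptions of the claim this limit is known to exist, and it equals $1$ if $j$ is the largest index with $a_j=\min_{1\le i\le n}a_i$ and $0$ otherwise. *)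

theory Defs
  imports "HOL-Analysis.Analysis"
begin

text \<open>
  \<open>C\<^sup>2\<close> up to the boundary: \<open>f\<close> is twice continuously Frechet differentiable on \<open>\<Omega>\<close>, and \<open>f\<close> together
  with its first and second derivative extends continuously to the closure. The values of \<open>f\<close>
  on the closure are those of the extension; off \<open>\<Omega>\<close>, \<open>D\<close> and \<open>H\<close> are the extended derivatives.
\<close>

definition C2_closure :: "(real ^ 'd) set \<Rightarrow> (real ^ 'd \<Rightarrow> real) \<Rightarrow> bool" where
  "C2_closure \<Omega> f \<longleftrightarrow> continuous_on (closure \<Omega>) f \<and>
     (\<exists>(D :: real ^ 'd \<Rightarrow> (real ^ 'd) \<Rightarrow>\<^sub>L real)
       (H :: real ^ 'd \<Rightarrow> (real ^ 'd) \<Rightarrow>\<^sub>L ((real ^ 'd) \<Rightarrow>\<^sub>L real)).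
        continuous_on (closure \<Omega>) D \<and> continuous_on (closure \<Omega>) H \<and>
        (\<forall>x\<in>\<Omega>. (f has_derivative blinfun_apply (D x)) (at x)) \<and>
        (\<forall>x\<in>\<Omega>. (D has_derivative blinfun_apply (H x)) (at x)))"

definition C11 :: "(real \<Rightarrow> real) \<Rightarrow> bool" where
  "C11 f \<longleftrightarrow> (\<forall>x. f differentiable (at x)) \<and> (\<exists>L. L-lipschitz_on UNIV (deriv f))"

definition L_infinity :: "(real \<Rightarrow> real) \<Rightarrow> bool" where
  "L_infinity f \<longleftrightarrow> f \<in> borel_measurable lebesgue \<and> (\<exists>C. AE x in lebesgue. \<bar>f x\<bar> \<le> C)"

text \<open>
  The second derivative of a \<open>C\<^sup>1\<^sup>,\<^sup>1\<close> function exists only almost everywhere, and \<^const>\<open>deriv\<close> returns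
  an arbitrary value where it does not; hence the explicit differentiability in the clause on
  its sign. The supremum bound is stated pointwise because a real-valued supremum
  is unspecified on unbounded sets.
\<close>

definition admissible_smoothing :: "(real \<Rightarrow> real \<Rightarrow> real) \<Rightarrow> bool" where
  "admissible_smoothing g \<longleftrightarrow>
     (\<forall>\<epsilon>>0. C11 (g \<epsilon>) \<and>
        (\<forall>x. 0 \<le> g \<epsilon> x \<and> deriv (g \<epsilon>) x \<in> {0..1}) \<and>
        (AE x in lebesgue. deriv (g \<epsilon>) differentiable (at x) \<and> 0 \<le> deriv (deriv (g \<epsilon>)) x) \<and>
        (\<forall>x. \<bar>max x 0 - g \<epsilon> x\<bar> \<le> \<epsilon>) \<and>
        L_infinity (deriv (deriv (g \<epsilon>)))) \<and>
     (\<forall>K. compact K \<and> K \<subseteq> UNIV - {0} \<longrightarrow>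
        uniform_limit K (\<lambda>\<epsilon>. deriv (g \<epsilon>)) (indicator {0..}) (at_right 0))"

text \<open>
  Points of \<open>\<real>\<^sup>n\<close> are functions \<^typ>\<open>nat \<Rightarrow> real\<close> of which only the entries \<open>1, \<dots>, n\<close> matter:
  \<open>smin h n a\<close> depends on no others. The first argument is a single member of the smoothing
  family; the value at index \<open>0\<close> is a dummy.
\<close>

fun smin :: "(real \<Rightarrow> real) \<Rightarrow> nat \<Rightarrow> (nat \<Rightarrow> real) \<Rightarrow> real" where
  "smin h 0 a = 0"
| "smin h (Suc 0) a = a 1"
| "smin h (Suc (Suc i)) a =
     a (Suc (Suc i)) - h (a (Suc (Suc i)) - smin h (Suc i) a)"

definition p_eps :: "(real \<Rightarrow> real \<Rightarrow> real) \<Rightarrow> nat \<Rightarrow> nat \<Rightarrow> real \<Rightarrow> (nat \<Rightarrow> real) \<Rightarrow> real" where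
  "p_eps g n j \<epsilon> a = deriv (\<lambda>t. smin (g \<epsilon>) n (a(j := t))) (a j)"

definition p_lim :: "(real \<Rightarrow> real \<Rightarrow> real) \<Rightarrow> nat \<Rightarrow> nat \<Rightarrow> (nat \<Rightarrow> real) \<Rightarrow> real" where
  "p_lim g n j a = Lim (at_right 0) (\<lambda>\<epsilon>. p_eps g n j \<epsilon> a)"

definition Omega_lim ::
  "(real \<Rightarrow> real \<Rightarrow> real) \<Rightarrow> (nat \<Rightarrow> real ^ 'd \<Rightarrow> real) \<Rightarrow> (real ^ 'd) set \<Rightarrow> nat \<Rightarrow> nat \<Rightarrow> (real ^ 'd) set"
where
  "Omega_lim g \<phi> \<Omega> n i =
     {x \<in> closure \<Omega>. p_lim g n i (\<lambda>k. \<phi> k x) = (MAX j\<in>{1..n}. p_lim g n j (\<lambda>k. \<phi> k x))}"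

definition Omega_eps ::
  "(real \<Rightarrow> real \<Rightarrow> real) \<Rightarrow> (nat \<Rightarrow> real ^ 'd \<Rightarrow> real) \<Rightarrow> (real ^ 'd) set \<Rightarrow> nat \<Rightarrow> nat \<Rightarrow> real
    \<Rightarrow> (real ^ 'd) set"
where
  "Omega_eps g \<phi> \<Omega> n i \<epsilon> =
     {x \<in> closure \<Omega>. p_eps g n i \<epsilon> (\<lambda>k. \<phi> k x) = (MAX j\<in>{1..n}. p_eps g n j \<epsilon> (\<lambda>k. \<phi> k x))}"

end

theory Submission
  imports Defs
begin

text \<open>
  Fix \<open>a = \<Phi>\<^sub>n(x)\<close>. By the chain rule, passing from \<open>n\<close> to \<open>n + 1\<close> multiplies the old partial
  derivatives by \<open>g\<^sub>\<epsilon>'(y\<^sub>\<epsilon>)\<close> and creates the new one \<open>1 - g\<^sub>\<epsilon>'(y\<^sub>\<epsilon>)\<close>, where \<open>y\<^sub>\<epsilon> = a\<^sub>n\<^sub>+\<^sub>1 - \<psi>\<^sub>n\<^sub>,\<^sub>\<epsilon>(a)\<close> tends to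
  \<open>a\<^sub>n\<^sub>+\<^sub>1 - min a\<close>. Away from \<open>0\<close> the factor converges to \<open>0\<close> or \<open>1\<close>. In the case of a tie,
  \<open>g\<^sub>\<epsilon>(r) \<le> (r)\<^sub>+\<close> forces \<open>\<psi>\<^sub>n\<^sub>,\<^sub>\<epsilon>(a) \<ge> min a\<close>, so \<open>y\<^sub>\<epsilon>\<close> approaches \<open>0\<close> from the left, where \<open>g\<^sub>\<epsilon>'\<close> is
  uniformly small. Hence exactly one partial derivative tends to \<open>1\<close> and the others to \<open>0\<close>, so
  that for small \<open>\<epsilon>\<close> the maximal one is unique and sits at the same index as in the limit.
\<close>

section \<open>Partial derivatives of the smoothed minimum\<close>

lemma smin_fun_upd_above:
  assumes "n < j"
  shows "smin h n (a(j := t)) = smin h n a"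
  using assms by (induction h n a rule: smin.induct) auto

lemma smin_differentiable:
  assumes "\<And>x. h differentiable (at x)"
  shows "(\<lambda>t. smin h n (a(j := t))) differentiable (at t)"
proof (induction n arbitrary: t rule: nat_induct)
  case (Suc n)
  have comp: "(\<lambda>t. h (f t)) differentiable (at t)"
    if "f differentiable (at t)" for f :: "real \<Rightarrow> real" and t
    using differentiable_chain_at[OF that assms] by (simp add: o_def)
  have upd: "(\<lambda>t. (a(j := t)) k) differentiable (at t)" for k t
    by (cases "k = j") auto
  show ?case
    \<comment> \<open>The recursion unfolds only once \<open>n\<close> is split, as
      \<open>smin\<close> starts at \<open>Suc 0\<close>; the update stays folded so that
      \<open>upd\<close> applies.\<close>
    by (cases n) (use upd Suc in \<open>auto intro!: differentiable_diff comp simp del: fun_upd_apply\<close>)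
qed simp

lemma deriv_smin_Suc_last:
  assumes "h differentiable (at (a (Suc n) - smin h n a))" and "n \<ge> 1"
  shows "deriv (\<lambda>t. smin h (Suc n) (a(Suc n := t))) (a (Suc n))
    = 1 - deriv h (a (Suc n) - smin h n a)"
proof -
  from \<open>n \<ge> 1\<close> obtain k where n: "n = Suc k"
    by (cases n) auto
  have "(h has_field_derivative deriv h (a (Suc n) - smin h n a)) (at (a (Suc n) - smin h n a))"
    using assms(1) by (simp add: DERIV_deriv_iff_real_differentiable)
  then have "((\<lambda>t. t - h (t - smin h n a)) has_field_derivative
      1 - deriv h (a (Suc n) - smin h n a) * 1) (at (a (Suc n)))"
    by (intro derivative_intros DERIV_chain2[where f = h]) (auto intro!: derivative_eq_intros)
  moreover have "smin h (Suc n) (a(Suc n := t)) = t - h (t - smin h n a)" for t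
    using smin_fun_upd_above[of n "Suc n" h a t] by (simp add: n)
  ultimately show ?thesis
    by (simp add: DERIV_imp_deriv)
qed

lemma deriv_smin_Suc_other:
  assumes "\<And>x. h differentiable (at x)" and "n \<ge> 1" and "j \<noteq> Suc n"
  shows "deriv (\<lambda>t. smin h (Suc n) (a(j := t))) (a j)
    = deriv h (a (Suc n) - smin h n a) * deriv (\<lambda>t. smin h n (a(j := t))) (a j)"
proof -
  from \<open>n \<ge> 1\<close> obtain k where n: "n = Suc k"
    by (cases n) auto
  let ?f = "\<lambda>t. smin h n (a(j := t))"
  let ?y = "a (Suc n) - smin h n a"
  have f: "(?f has_field_derivative deriv ?f (a j)) (at (a j))"
    using smin_differentiable[OF assms(1)] by (simp add: DERIV_deriv_iff_real_differentiable)
  have h: "(h has_field_derivative deriv h ?y) (at ?y)"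
    using assms(1) by (simp add: DERIV_deriv_iff_real_differentiable)
  have "((\<lambda>t. a (Suc n) - h (a (Suc n) - ?f t)) has_field_derivative
      0 - deriv h ?y * (0 - deriv ?f (a j))) (at (a j))"
    \<comment> \<open>The base point \<open>a (Suc n) - ?f (a j)\<close> is \<open>?y\<close>,
      because \<open>a(j := a j) = a\<close>.\<close>
    by (intro DERIV_diff DERIV_const DERIV_chain2[where f = h] f) (simp add: h)
  moreover have "smin h (Suc n) (a(j := t)) = a (Suc n) - h (a (Suc n) - ?f t)" for t
    using assms(3) by (simp add: n)
  ultimately show ?thesis
    by (simp add: DERIV_imp_deriv)
qed

lemma p_eps_Suc:
  assumes "admissible_smoothing g" and "\<epsilon> > 0" and "n \<ge> 1"
  shows "p_eps g (Suc n) j \<epsilon> a =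
    (if j = Suc n then 1 - deriv (g \<epsilon>) (a (Suc n) - smin (g \<epsilon>) n a)
     else deriv (g \<epsilon>) (a (Suc n) - smin (g \<epsilon>) n a) * p_eps g n j \<epsilon> a)"
proof -
  have "g \<epsilon> differentiable (at x)" for x
    using assms(1,2) by (simp add: admissible_smoothing_def C11_def)
  then show ?thesis
    unfolding p_eps_def using assms(3) by (simp add: deriv_smin_Suc_last deriv_smin_Suc_other)
qed

section \<open>Limits of the smoothing along moving arguments\<close>

text \<open>The argument moves with \<epsilon>, so pointwise convergence would not do; uniform
  convergence on a compact neighbourhood of \<open>l\<close> does.\<close>

lemma tendsto_deriv_smoothing_nonzero:
  assumes g: "admissible_smoothing g"
    and y: "(y \<longlongrightarrow> l) (at_right 0)" and l: "l \<noteq> 0"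
  shows "((\<lambda>\<epsilon>. deriv (g \<epsilon>) (y \<epsilon>)) \<longlongrightarrow> of_bool (l > 0)) (at_right 0)"
proof -
  \<comment> \<open>Half of \<open>\<bar>l\<bar>\<close> as radius keeps \<open>K\<close> on one
    side of 0, where the indicator is constant.\<close>
  define K where "K = cball l (\<bar>l\<bar> / 2)"
  have "compact K" "K \<subseteq> UNIV - {0}"
    using l by (auto simp: K_def dist_real_def)
  then have unif: "uniform_limit K (\<lambda>\<epsilon>. deriv (g \<epsilon>)) (indicator {0..}) (at_right 0)"
    using g by (auto simp: admissible_smoothing_def)
  have ind: "indicator {0..} x = (of_bool (l > 0) :: real)" if "x \<in> K" for x
    using that l by (auto simp: K_def dist_real_def indicator_def abs_if split: if_splits)
  have K: "\<forall>\<^sub>F \<epsilon> in at_right 0. y \<epsilon> \<in> K"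
    using tendstoD[OF y, of "\<bar>l\<bar> / 2"] l
    by (auto elim!: eventually_mono simp: K_def dist_commute)
  show ?thesis
  proof (rule tendstoI)
    fix e :: real
    assume "e > 0"
    from uniform_limitD[OF unif this] K
    show "\<forall>\<^sub>F \<epsilon> in at_right 0. dist (deriv (g \<epsilon>) (y \<epsilon>)) (of_bool (l > 0)) < e"
      by eventually_elim (use ind in fastforce)
  qed
qed

text \<open>Uniform convergence says nothing near 0; there the one-sided bound on
  \<open>{-s0..0}\<close> takes over, as \<open>y\<close> eventually stays in that interval.\<close>

lemma tendsto_deriv_smoothing_nonpos:
  assumes g: "admissible_smoothing g"
    and "s0 > 0" and sup: "((\<lambda>\<epsilon>. SUP s\<in>{-s0..0}. \<bar>deriv (g \<epsilon>) s\<bar>) \<longlongrightarrow> 0) (at_right 0)"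
    and y: "(y \<longlongrightarrow> 0) (at_right 0)" and y_le: "\<And>\<epsilon>. \<epsilon> > 0 \<Longrightarrow> y \<epsilon> \<le> 0"
  shows "((\<lambda>\<epsilon>. deriv (g \<epsilon>) (y \<epsilon>)) \<longlongrightarrow> 0) (at_right 0)"
proof (rule Lim_null_comparison[OF _ sup])
  have "\<forall>\<^sub>F \<epsilon> in at_right 0. - s0 < y \<epsilon>"
    using order_tendstoD(1)[OF y] \<open>s0 > 0\<close> by simp
  then show "\<forall>\<^sub>F \<epsilon> in at_right 0. norm (deriv (g \<epsilon>) (y \<epsilon>)) \<le> (SUP s\<in>{-s0..0}. \<bar>deriv (g \<epsilon>) s\<bar>)"
    using eventually_at_right_less[of 0]
  proof eventually_elim
    case (elim \<epsilon>)
    have "deriv (g \<epsilon>) s \<in> {0..1}" for s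
      using g elim by (auto simp: admissible_smoothing_def)
    \<comment> \<open>Boundedness is what makes the real-valued \<open>SUP\<close> an upper
      bound.\<close>
    then have "bdd_above ((\<lambda>s. \<bar>deriv (g \<epsilon>) s\<bar>) ` {-s0..0})"
      by (intro bdd_aboveI[of _ 1]) auto
    then show ?case
      using elim y_le[of \<epsilon>] by (auto intro!: cSUP_upper)
  qed
qed

lemma tendsto_smoothing:
  assumes "admissible_smoothing g" and y: "(y \<longlongrightarrow> l) (at_right 0)"
  shows "((\<lambda>\<epsilon>. g \<epsilon> (y \<epsilon>)) \<longlongrightarrow> max l 0) (at_right 0)"
proof -
  have "\<forall>\<^sub>F \<epsilon> in at_right 0. norm (max (y \<epsilon>) 0 - g \<epsilon> (y \<epsilon>)) \<le> \<epsilon>"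
    using eventually_at_right_less[of 0]
    by eventually_elim (use assms in \<open>simp add: admissible_smoothing_def\<close>)
  then have "((\<lambda>\<epsilon>. max (y \<epsilon>) 0 - g \<epsilon> (y \<epsilon>)) \<longlongrightarrow> 0) (at_right 0)"
    by (rule Lim_null_comparison) (rule tendsto_ident_at)
  then have "((\<lambda>\<epsilon>. max (y \<epsilon>) 0 - (max (y \<epsilon>) 0 - g \<epsilon> (y \<epsilon>))) \<longlongrightarrow> max l 0 - 0) (at_right 0)"
    by (intro tendsto_diff tendsto_max y tendsto_const)
  then show ?thesis
    by simp
qed

text \<open>The lower bound on \<open>smin\<close> is carried through the induction because the
  limit alone leaves the sign of the next argument open at a tie.\<close>

lemma p_eps_tendsto_unit_vector:
  assumes g: "admissible_smoothing g"
    and below: "\<forall>\<epsilon>>0. \<forall>r. g \<epsilon> r \<le> max r 0"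
    and s0: "s0 > 0" "((\<lambda>\<epsilon>. SUP s\<in>{-s0..0}. \<bar>deriv (g \<epsilon>) s\<bar>) \<longlongrightarrow> 0) (at_right 0)"
    and "n \<ge> 1"
  shows "\<exists>m\<in>{1..n}. (\<forall>\<epsilon>>0. a m \<le> smin (g \<epsilon>) n a) \<and>
    ((\<lambda>\<epsilon>. smin (g \<epsilon>) n a) \<longlongrightarrow> a m) (at_right 0) \<and>
    (\<forall>j\<in>{1..n}. ((\<lambda>\<epsilon>. p_eps g n j \<epsilon> a) \<longlongrightarrow> of_bool (j = m)) (at_right 0))"
  using \<open>n \<ge> 1\<close>
proof (induction n rule: nat_induct_at_least)
  case base
  have "p_eps g 1 1 \<epsilon> a = 1" for \<epsilon>
    by (simp add: p_eps_def)
  then show ?case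
    by simp
next
  case (Suc n)
  then obtain m where m: "m \<in> {1..n}"
    and lower: "\<And>\<epsilon>. \<epsilon> > 0 \<Longrightarrow> a m \<le> smin (g \<epsilon>) n a"
    and lim: "((\<lambda>\<epsilon>. smin (g \<epsilon>) n a) \<longlongrightarrow> a m) (at_right 0)"
    and p: "\<And>j. j \<in> {1..n} \<Longrightarrow> ((\<lambda>\<epsilon>. p_eps g n j \<epsilon> a) \<longlongrightarrow> of_bool (j = m)) (at_right 0)"
    by blast
  define y where "y \<epsilon> = a (Suc n) - smin (g \<epsilon>) n a" for \<epsilon>
  have smin_Suc: "smin (g \<epsilon>) (Suc n) a = a (Suc n) - g \<epsilon> (y \<epsilon>)" for \<epsilon>
    using Suc.hyps by (cases n) (auto simp: y_def)
  have y: "(y \<longlongrightarrow> a (Suc n) - a m) (at_right 0)"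
    unfolding y_def by (intro tendsto_diff tendsto_const lim)
  \<comment> \<open>The non-strict comparison gives a tie to the newer index, hence the largest
    minimizing index.\<close>
  define m' where "m' = (if a (Suc n) \<le> a m then Suc n else m)"
  have a_m': "a m' = min (a (Suc n)) (a m)"
    by (simp add: m'_def min_def)
  have deriv_lim: "((\<lambda>\<epsilon>. deriv (g \<epsilon>) (y \<epsilon>)) \<longlongrightarrow> of_bool (m' \<noteq> Suc n)) (at_right 0)"
  proof (cases "a (Suc n) = a m")
    case True
    have "((\<lambda>\<epsilon>. deriv (g \<epsilon>) (y \<epsilon>)) \<longlongrightarrow> 0) (at_right 0)"
    proof (rule tendsto_deriv_smoothing_nonpos[OF g s0])
      show "(y \<longlongrightarrow> 0) (at_right 0)"
        using y True by simp
      show "y \<epsilon> \<le> 0" if "\<epsilon> > 0" for \<epsilon>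
        using lower[OF that] True by (simp add: y_def)
    qed
    then show ?thesis
      using True by (simp add: m'_def)
  next
    case False
    moreover have "a (Suc n) - a m > 0 \<longleftrightarrow> m' \<noteq> Suc n"
      using m by (auto simp: m'_def)
    ultimately show ?thesis
      using tendsto_deriv_smoothing_nonzero[OF g y] by simp
  qed
  have "a m' \<le> smin (g \<epsilon>) (Suc n) a" if "\<epsilon> > 0" for \<epsilon>
  proof -
    \<comment> \<open>Subtracting at most the positive part of \<open>y \<epsilon>\<close> from
      \<open>a (Suc n)\<close> leaves at least the minimum of \<open>a (Suc n)\<close> and
      \<open>smin (g \<epsilon>) n a\<close>.\<close>
    have "g \<epsilon> (y \<epsilon>) \<le> max (y \<epsilon>) 0"
      using below that by blast
    then show ?thesis
      using lower[OF that] by (auto simp: smin_Suc a_m' y_def)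
  qed
  moreover have "((\<lambda>\<epsilon>. smin (g \<epsilon>) (Suc n) a) \<longlongrightarrow> a m') (at_right 0)"
  proof -
    have "a m' = a (Suc n) - max (a (Suc n) - a m) 0"
      by (simp add: a_m' min_def max_def)
    then show ?thesis
      unfolding smin_Suc using tendsto_diff[OF tendsto_const tendsto_smoothing[OF g y]] by simp
  qed
  moreover have "((\<lambda>\<epsilon>. p_eps g (Suc n) j \<epsilon> a) \<longlongrightarrow> of_bool (j = m')) (at_right 0)"
    if j: "j \<in> {1..Suc n}" for j
  proof -
    have eq: "\<forall>\<^sub>F \<epsilon> in at_right 0. (if j = Suc n then 1 - deriv (g \<epsilon>) (y \<epsilon>)
        else deriv (g \<epsilon>) (y \<epsilon>) * p_eps g n j \<epsilon> a) = p_eps g (Suc n) j \<epsilon> a"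
      using eventually_at_right_less[of 0]
      by eventually_elim (use p_eps_Suc[OF g _ Suc.hyps] in \<open>simp add: y_def\<close>)
    have "((\<lambda>\<epsilon>. if j = Suc n then 1 - deriv (g \<epsilon>) (y \<epsilon>)
        else deriv (g \<epsilon>) (y \<epsilon>) * p_eps g n j \<epsilon> a) \<longlongrightarrow> of_bool (j = m')) (at_right 0)"
    proof (cases "j = Suc n")
      case True
      then show ?thesis
        using tendsto_diff[OF tendsto_const deriv_lim, of 1] by (auto split: if_splits)
    next
      case False
      \<comment> \<open>Since \<open>m \<le> n\<close>, an old index \<open>j\<close> is selected
        exactly if the old choice survives and \<open>j = m\<close>.\<close>
      then have "of_bool (j = m') = (of_bool (m' \<noteq> Suc n) * of_bool (j = m) :: real)"
        using m by (auto simp: m'_def)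
      then show ?thesis
        using False j tendsto_mult[OF deriv_lim p[of j]] by simp
    qed
    then show ?thesis
      by (rule Lim_transform_eventually[OF _ eq])
  qed
  moreover have "m' \<in> {1..Suc n}"
    using m by (auto simp: m'_def)
  ultimately show ?case
    by blast
qed

text \<open>A strict maximizer is unique. This serves both the limit and each small \<epsilon>,
  reducing both memberships to \<open>i = m\<close>.\<close>

lemma eq_Max_iff_strict:
  fixes f :: "'a \<Rightarrow> 'b::linorder"
  assumes "finite A" and "m \<in> A" and "i \<in> A"
    and less: "\<And>j. j \<in> A \<Longrightarrow> j \<noteq> m \<Longrightarrow> f j < f m"
  shows "f i = (MAX j\<in>A. f j) \<longleftrightarrow> i = m"
proof -
  have "(MAX j\<in>A. f j) = f m"
    using assms by (intro Max_eqI) (auto intro: less_imp_le)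
  then show ?thesis
    using less[OF \<open>i \<in> A\<close>] by force
qed

theorem proposition3p2:
  fixes \<Omega> :: "(real ^ 'd) set"
    and n :: nat
    and \<phi> :: "nat \<Rightarrow> real ^ 'd \<Rightarrow> real"
    and g :: "real \<Rightarrow> real \<Rightarrow> real"
  assumes "open \<Omega>" and "bounded \<Omega>" and "convex \<Omega>"
    and "n \<ge> 1"
    and "\<forall>i\<in>{1..n}. C2_closure \<Omega> (\<phi> i)"
    and "admissible_smoothing g"
    and "\<forall>\<epsilon>>0. \<forall>r. g \<epsilon> r \<le> max r 0"
    and "\<exists>s0>0. ((\<lambda>\<epsilon>. SUP s\<in>{-s0..0}. \<bar>deriv (g \<epsilon>) s\<bar>) \<longlongrightarrow> 0) (at_right 0)"
  shows "\<forall>x\<in>closure \<Omega>. \<forall>i\<in>{1..n}.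
           ((\<lambda>\<epsilon>. indicator (Omega_eps g \<phi> \<Omega> n i \<epsilon>) x :: real) \<longlongrightarrow>
             indicator (Omega_lim g \<phi> \<Omega> n i) x) (at_right 0)"
proof (intro ballI)
  fix x i
  assume x: "x \<in> closure \<Omega>" and i: "i \<in> {1..n}"
  define a where "a = (\<lambda>k. \<phi> k x)"
  from assms(8) obtain s0 where
    "s0 > 0" "((\<lambda>\<epsilon>. SUP s\<in>{-s0..0}. \<bar>deriv (g \<epsilon>) s\<bar>) \<longlongrightarrow> 0) (at_right 0)"
    by blast
  from p_eps_tendsto_unit_vector[OF assms(6,7) this assms(4), of a] obtain m where
    m: "m \<in> {1..n}" and
    p: "\<And>j. j \<in> {1..n} \<Longrightarrow> ((\<lambda>\<epsilon>. p_eps g n j \<epsilon> a) \<longlongrightarrow> of_bool (j = m)) (at_right 0)"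
    by blast
  \<comment> \<open>\<open>Lim\<close> is determined here because convergence is known and
    \<open>at_right 0\<close> is a nontrivial filter.\<close>
  have "p_lim g n j a = of_bool (j = m)" if "j \<in> {1..n}" for j
    unfolding p_lim_def by (rule tendsto_Lim[OF _ p[OF that]]) simp
  then have "p_lim g n i a = (MAX j\<in>{1..n}. p_lim g n j a) \<longleftrightarrow> i = m"
    using m i by (intro eq_Max_iff_strict) auto
  then have lim: "x \<in> Omega_lim g \<phi> \<Omega> n i \<longleftrightarrow> i = m"
    using x by (simp add: Omega_lim_def a_def)
  have "\<forall>\<^sub>F \<epsilon> in at_right 0. p_eps g n j \<epsilon> a < p_eps g n m \<epsilon> a"
    if "j \<in> {1..n} - {m}" for j
  proof -
    \<comment> \<open>Any threshold strictly between the limits 0 and 1 separates the two;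
      \<open>1 / 2\<close> is one.\<close>
    have "\<forall>\<^sub>F \<epsilon> in at_right 0. p_eps g n j \<epsilon> a < 1 / 2"
      using order_tendstoD(2)[OF p[of j], of "1 / 2"] that by simp
    moreover have "\<forall>\<^sub>F \<epsilon> in at_right 0. 1 / 2 < p_eps g n m \<epsilon> a"
      using order_tendstoD(1)[OF p[OF m], of "1 / 2"] by simp
    ultimately show ?thesis
      by eventually_elim simp
  qed
  then have "\<forall>\<^sub>F \<epsilon> in at_right 0. \<forall>j\<in>{1..n} - {m}. p_eps g n j \<epsilon> a < p_eps g n m \<epsilon> a"
    by (intro eventually_ball_finite) auto
  then have "\<forall>\<^sub>F \<epsilon> in at_right 0.
      indicator (Omega_lim g \<phi> \<Omega> n i) x = (indicator (Omega_eps g \<phi> \<Omega> n i \<epsilon>) x :: real)"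
  proof eventually_elim
    case (elim \<epsilon>)
    then have "p_eps g n i \<epsilon> a = (MAX j\<in>{1..n}. p_eps g n j \<epsilon> a) \<longleftrightarrow> i = m"
      using m i by (intro eq_Max_iff_strict) auto
    then have "x \<in> Omega_eps g \<phi> \<Omega> n i \<epsilon> \<longleftrightarrow> i = m"
      using x by (simp add: Omega_eps_def a_def)
    with lim show ?case
      by (simp add: indicator_def)
  qed
  \<comment> \<open>The indicator is eventually constant in \<epsilon> and already equal to its
    limit.\<close>
  then show "((\<lambda>\<epsilon>. indicator (Omega_eps g \<phi> \<Omega> n i \<epsilon>) x :: real) \<longlongrightarrow>
      indicator (Omega_lim g \<phi> \<Omega> n i) x) (at_right 0)"
    by (rule Lim_transform_eventually[OF tendsto_const])
qed

end
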